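(* Let $G:\mathbb{R}^d\to\mathbb{R}$ be differentiable, and assume there is $L_1>0$ with $\|\nabla G(\theta)-\nabla G(\theta')\|\le L_1\|\theta-\theta'\|$ for all $\theta,\theta'\in\mathbb{R}^d$. Let $\theta^*$ be a global minimizer of $G$. Fix $n\ge1$ and a deterministic $\theta_1\in\mathbb{R}^d$, and let $$\theta_{k+1}=\theta_k-\zeta(k)\,\widehat\nabla G(\theta_k),\qquad k=1,\dots,n,$$ where $\widehat\nabla G(\theta_k)$ is a random vector in $\mathbb{R}^d$. Let $\mathcal{F}_k=\sigma(\theta_m,m\le k)$, and let $\theta_R$ be chosen uniformly at random from $\{\theta_1,\dots,\theta_n\}$, i.e. $R$ is uniform on $\{1,\dots,n\}$ and independent of everything else. (i) Suppose there is $\sigma<\infty$ such that for all $k$, $\mathbb{E}[\widehat\nabla G(\theta_k)\mid\mathcal{F}_k]=\nabla G(\theta_k)$ and $\mathbb{E}\|\widehat\nabla G(\theta_k)-\nabla G(\theta_k)\|^2\le\sigma^2$. If $\zeta(k)=\min\{1/L_1,1/\sqrt n\}$ for $k=1,\dots,n$, then $$\mathbb{E}\|\nabla G(\theta_R)\|^2\le\frac{2L_1(G(\theta_1)-G(\theta^* ))}{n}+\frac{2(G(\theta_1)-G(\theta^* ))+L_1\sigma^2}{\sqrt n}.$$ (ii) Suppose instead that there are constants $C_1,C_2$ and parameters $\delta_k>0$ such that for all $k$, $\|\mathbb{E}[\widehat\nabla G(\theta_k)\mid\mathcal{F}_k]-\nabla G(\theta_k)\|\le C_1\delta_k^2$ and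 $\mathbb{E}\|\widehat\nabla G(\theta_k)\|^2<C_2/\delta_k^2$, and that $\|\nabla G(\theta)\|_1\le B$ for all $\theta\in\mathbb{R}^d$. If $\zeta(k)=\min\{1/L_1,1/n^{2/3}\}$ and $\delta_k=1/n^{1/6}$ for $k=1,\dots,n$, then $$\mathbb{E}\|\nabla G(\theta_R)\|^2\le\frac{2(G(\theta_1)-G(\theta^* ))}{n}\max\{L_1,n^{2/3}\}+\frac{4BC_1+L_1C_2}{n^{1/3}}+\frac{L_1\,d\,C_1^2}{n^{4/3}}.$$
   Context: $\|\cdot\|$ is the Euclidean norm and $\|\cdot\|_1$ the $\ell_1$-norm on $\mathbb{R}^d$. *)

theory Defs
  imports "HOL-Probability.Probability"
begin

definition l1_norm :: "real ^ 'd \<Rightarrow> real" where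
  "l1_norm x = (\<Sum>i\<in>UNIV. \<bar>x $ i\<bar>)"

definition sigma_of :: "'w measure \<Rightarrow> ('w \<Rightarrow> 'b::topological_space) set \<Rightarrow> 'w measure" where
  "sigma_of M S = sigma (space M) (\<Union>X\<in>S. {X -` A \<inter> space M | A. A \<in> sets borel})"

(* The library's real_cond_exp covers real-valued functions only; for a random vector the
   conditional expectation is taken coordinatewise. *)
definition vec_cond_exp ::
    "'w measure \<Rightarrow> 'w measure \<Rightarrow> ('w \<Rightarrow> real ^ 'd) \<Rightarrow> 'w \<Rightarrow> real ^ 'd" where
  "vec_cond_exp M F X = (\<lambda>\<omega>. \<chi> i. real_cond_exp M F (\<lambda>\<omega>'. X \<omega>' $ i) \<omega>)"

end

(* By the descent lemma,
     G(\<theta> (k+1)) \<le> G(\<theta> k) - \<zeta> <\<nabla>G(\<theta> k), g k> + L/2 \<zeta>^2 |g k|^2.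
   In expectation, the tower property replaces g k in the inner product by its conditional
   expectation, which is \<nabla>G(\<theta> k) up to the bias.  Telescoping over k bounds the average of
   E|\<nabla>G(\<theta> k)|^2, which equals E|\<nabla>G(\<theta> R)|^2 by independence and uniformity of R.
   In the biased case the second moment of g is estimated directly, so the d * C1^2 term of the
   claim is pure slack. *)
theory Submission
  imports Defs
begin

section \<open>Square-integrable random vectors\<close>

text \<open>Integrability of the iterates, and of \<open>G\<close> and \<open>gradG\<close> along
  them, is not among the hypotheses, and the Bochner integral of a non-integrable function is 0 by
  convention. Each expectation therefore needs its own integrability proof. All of them reduce to
  second moments: a Lipschitz gradient grows at most linearly, and \<open>G\<close>, squeezed
  between its minimum and a quadratic, grows at most quadratically. So square-integrability of
  \<open>\<theta> k\<close> passes to every term of the descent inequality. The two parts differ in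
  how much of the descent term survives. Under unbiasedness the second moment of \<open>g k\<close>
  contains the expected squared gradient itself; a step of at most 1/L lets half of the descent term
  absorb it, and the remaining factor z/2 is the origin of the 2 in the first bound. With a directly
  bounded second moment the whole factor z survives, and the bias costs at most \<open>B\<close>
  times its size at each step.\<close>

lemma abs_inner_le_sum_squares: "\<bar>x \<bullet> y\<bar> \<le> (norm x)\<^sup>2 + (norm y)\<^sup>2"
proof -
  have "\<bar>x \<bullet> y\<bar> \<le> norm x * norm y"
    by (rule Cauchy_Schwarz_ineq2)
  also have "\<dots> \<le> (norm x)\<^sup>2 + (norm y)\<^sup>2"
    using sum_squares_bound[of "norm x" "norm y"] mult_nonneg_nonneg[OF norm_ge_zero[of x] norm_ge_zero[of y]]
    by linarith
  finally show ?thesis .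
qed

lemma norm_add_squared_le: "(norm (x + y))\<^sup>2 \<le> 2 * (norm x)\<^sup>2 + 2 * (norm y)\<^sup>2"
  for x y :: "'a::real_normed_vector"
proof -
  have "(norm (x + y))\<^sup>2 \<le> (norm x + norm y)\<^sup>2"
    by (intro power_mono norm_triangle_ineq) auto
  also have "\<dots> \<le> 2 * (norm x)\<^sup>2 + 2 * (norm y)\<^sup>2"
    using sum_squares_bound[of "norm x" "norm y"] by (simp add: power2_sum)
  finally show ?thesis .
qed

text \<open>Pointwise domination by the sum of the two squared norms suffices; the constant is
  irrelevant, as only integrability is wanted.\<close>

lemma integrable_inner_of_squares:
  fixes X Y :: "'w \<Rightarrow> 'a::euclidean_space"
  assumes [measurable]: "X \<in> borel_measurable M" "Y \<in> borel_measurable M"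
    and "integrable M (\<lambda>\<omega>. (norm (X \<omega>))\<^sup>2)" "integrable M (\<lambda>\<omega>. (norm (Y \<omega>))\<^sup>2)"
  shows "integrable M (\<lambda>\<omega>. X \<omega> \<bullet> Y \<omega>)"
  by (rule Bochner_Integration.integrable_bound[OF Bochner_Integration.integrable_add[OF assms(3,4)]])
     (auto intro!: abs_inner_le_sum_squares order_trans[OF _ abs_ge_self])

lemma integrable_norm_add_squared:
  fixes X Y :: "'w \<Rightarrow> 'a::euclidean_space"
  assumes [measurable]: "X \<in> borel_measurable M" "Y \<in> borel_measurable M"
    and int: "integrable M (\<lambda>\<omega>. (norm (X \<omega>))\<^sup>2)" "integrable M (\<lambda>\<omega>. (norm (Y \<omega>))\<^sup>2)"
  shows "integrable M (\<lambda>\<omega>. (norm (X \<omega> + Y \<omega>))\<^sup>2)"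
proof (rule Bochner_Integration.integrable_bound)
  show "integrable M (\<lambda>\<omega>. 2 * (norm (X \<omega>))\<^sup>2 + 2 * (norm (Y \<omega>))\<^sup>2)"
    using int by auto
qed (auto intro!: norm_add_squared_le order_trans[OF _ abs_ge_self])

text \<open>The rule of pulling out a factor known to \<open>F\<close>, combined with the tower
  property. Since \<open>vec_cond_exp\<close> acts coordinatewise, the scalar rule is applied to
  each product of coordinates and the results are summed. Those products are integrable because a
  coordinate is bounded by the norm of its vector.\<close>

lemma (in sigma_finite_subalgebra) vec_cond_exp_inner:
  fixes V X :: "'a \<Rightarrow> real ^ 'd"
  assumes [measurable]: "V \<in> borel_measurable F" "X \<in> borel_measurable M"
    and int: "integrable M (\<lambda>\<omega>. (norm (V \<omega>))\<^sup>2)" "integrable M (\<lambda>\<omega>. (norm (X \<omega>))\<^sup>2)"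
  shows "integrable M (\<lambda>\<omega>. V \<omega> \<bullet> vec_cond_exp M F X \<omega>)"
    and "(\<integral>\<omega>. V \<omega> \<bullet> vec_cond_exp M F X \<omega> \<partial>M) = (\<integral>\<omega>. V \<omega> \<bullet> X \<omega> \<partial>M)"
proof -
  have [measurable]: "V \<in> borel_measurable M"
    by (rule measurable_from_subalg[OF subalg assms(1)])
  have nth [measurable]: "(\<lambda>v. v $ i) \<in> borel_measurable borel" for i :: 'd
    by (intro borel_measurable_continuous_onI continuous_intros)
  have coord: "integrable M (\<lambda>\<omega>. V \<omega> $ i * X \<omega> $ i)" for i
  proof (rule Bochner_Integration.integrable_bound)
    show "integrable M (\<lambda>\<omega>. (norm (V \<omega>))\<^sup>2 + (norm (X \<omega>))\<^sup>2)"
      using int by auto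
    have "\<bar>v $ i * x $ i\<bar> \<le> (norm v)\<^sup>2 + (norm x)\<^sup>2" for v x :: "real ^ 'd"
    proof -
      have "\<bar>v $ i * x $ i\<bar> \<le> (norm (v $ i))\<^sup>2 + (norm (x $ i))\<^sup>2"
        using abs_inner_le_sum_squares[of "v $ i" "x $ i"] by simp
      also have "\<dots> \<le> (norm v)\<^sup>2 + (norm x)\<^sup>2"
        by (intro add_mono power_mono Finite_Cartesian_Product.norm_nth_le) auto
      finally show ?thesis .
    qed
    then show "AE \<omega> in M. norm (V \<omega> $ i * X \<omega> $ i) \<le> norm ((norm (V \<omega>))\<^sup>2 + (norm (X \<omega>))\<^sup>2)"
      by (auto intro!: order_trans[OF _ abs_ge_self])
  qed measurable
  have F: "(\<lambda>\<omega>. V \<omega> $ i) \<in> borel_measurable F" for i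
    by measurable
  have X: "(\<lambda>\<omega>. X \<omega> $ i) \<in> borel_measurable M" for i
    by measurable
  note tower = real_cond_exp_intg[OF coord F X]
  show "integrable M (\<lambda>\<omega>. V \<omega> \<bullet> vec_cond_exp M F X \<omega>)"
    unfolding inner_vec_def vec_cond_exp_def using tower(1) by simp
  show "(\<integral>\<omega>. V \<omega> \<bullet> vec_cond_exp M F X \<omega> \<partial>M) = (\<integral>\<omega>. V \<omega> \<bullet> X \<omega> \<partial>M)"
    unfolding inner_vec_def vec_cond_exp_def using tower coord by simp
qed

section \<open>Generated sigma-algebras and a uniform random index\<close>

lemma space_sigma_of [simp]: "space (sigma_of M S) = space M"
  unfolding sigma_of_def by (rule space_measure_of) auto

lemma measurable_sigma_of:
  assumes "X \<in> S"
  shows "X \<in> borel_measurable (sigma_of M S)"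
proof (rule measurableI)
  fix A :: "'b set" assume "A \<in> sets borel"
  then have "X -` A \<inter> space M \<in> (\<Union>X\<in>S. {X -` A \<inter> space M | A. A \<in> sets borel})"
    using assms by auto
  then show "X -` A \<inter> space (sigma_of M S) \<in> sets (sigma_of M S)"
    unfolding space_sigma_of by (subst sigma_of_def, subst sets_measure_of) auto
qed auto

lemma subalgebra_sigma_of:
  assumes "\<And>X. X \<in> S \<Longrightarrow> X \<in> borel_measurable M"
  shows "subalgebra M (sigma_of M S)"
proof -
  have "sigma_sets (space M) (\<Union>X\<in>S. {X -` A \<inter> space M | A. A \<in> sets borel}) \<subseteq> sets M"
    by (rule sets.sigma_sets_subset) (auto intro: measurable_sets[OF assms])
  then show ?thesis
    unfolding subalgebra_def by (subst (2) sigma_of_def, subst sets_measure_of) auto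
qed

text \<open>Splitting over the value of the index gives the sum of
  \<open>indicator {k} (R \<omega>) * f k \<omega>\<close>. Independence factors the expectation of
  each summand, and uniformity makes the first factor \<open>1 / card A\<close>. Measurability of
  \<open>f k\<close> with respect to \<open>F\<close>, not merely \<open>M\<close>, is what places
  it on the other side of the independence.\<close>

lemma (in prob_space) uniform_index_expectation:
  fixes f :: "'i::topological_space \<Rightarrow> 'a \<Rightarrow> real"
  assumes A: "finite A" "A \<noteq> {}" "\<And>k. k \<in> A \<Longrightarrow> {k} \<in> sets borel"
    and R [measurable]: "R \<in> measurable M (count_space A)"
    and unif: "distr M (count_space A) R = uniform_count_measure A"
    and F: "subalgebra M F"
    and indep: "indep_set (sets (sigma_of M {R})) (sets F)"
    and f: "\<And>k. k \<in> A \<Longrightarrow> f k \<in> borel_measurable F" "\<And>k. k \<in> A \<Longrightarrow> integrable M (f k)"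
  shows "integrable M (\<lambda>\<omega>. f (R \<omega>) \<omega>)"
    and "expectation (\<lambda>\<omega>. f (R \<omega>) \<omega>) = (\<Sum>k\<in>A. expectation (f k)) / real (card A)"
proof -
  define e where "e k \<omega> = (indicator {k} (R \<omega>) :: real)" for k \<omega>
  have e_meas: "e k \<in> borel_measurable M" for k
    unfolding e_def by (rule measurable_compose[OF R]) simp
  have e_int: "integrable M (e k)" for k
    by (rule integrable_const_bound[of _ 1]) (use e_meas in \<open>auto simp: e_def\<close>)
  have prob: "expectation (e k) = 1 / real (card A)" if k: "k \<in> A" for k
  proof -
    have "expectation (e k) = integral\<^sup>L (distr M (count_space A) R) (indicator {k})"
      unfolding e_def by (subst integral_distr) auto
    also have "\<dots> = 1 / real (card A)"
      unfolding unif integral_uniform_count_measure[OF A(1)]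
      using A k by (simp add: indicator_def sum.If_cases)
    finally show ?thesis .
  qed
  \<comment> \<open>\<open>sigma_of\<close> is built from Borel preimages, whereas \<open>R\<close>
    is measurable into a count space; Borel singletons bridge the two.\<close>
  have e_sigma: "e k \<in> borel_measurable (sigma_of M {R})" if "k \<in> A" for k
  proof -
    have "(indicator {k} :: 'i \<Rightarrow> real) \<in> borel_measurable borel"
      using A(3)[OF that] by (rule borel_measurable_indicator)
    from measurable_compose[OF measurable_sigma_of[of R "{R}" M] this] show ?thesis
      unfolding e_def by simp
  qed
  have iv: "indep_var borel (e k) borel (f k)" if k: "k \<in> A" for k
    unfolding indep_var_eq
  proof (intro conjI e_meas)
    show "f k \<in> borel_measurable M"
      by (rule measurable_from_subalg[OF F f(1)[OF k]])
    \<comment> \<open>Independence passes to smaller sigma-algebras: those generated by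
      \<open>e k\<close> and \<open>f k\<close> lie inside \<open>sigma_of M {R}\<close> and
      \<open>F\<close>.\<close>
    have preimages: "sigma_sets (space M) {h -` B \<inter> space M | B. B \<in> sets borel} \<subseteq> sets N"
      if "space N = space M" "h \<in> borel_measurable N" for h :: "'a \<Rightarrow> real" and N
    proof -
      have "{h -` B \<inter> space M | B. B \<in> sets borel} \<subseteq> sets N"
        using measurable_sets[OF that(2)] unfolding that(1) by auto
      from sets.sigma_sets_subset[OF this] show ?thesis
        unfolding that(1) .
    qed
    have "space F = space M"
      using F by (simp add: subalgebra_def)
    note 1 = preimages[OF space_sigma_of e_sigma[OF k]] and 2 = preimages[OF this f(1)[OF k]]
    show "indep_set (sigma_sets (space M) {e k -` B \<inter> space M | B. B \<in> sets borel})
        (sigma_sets (space M) {f k -` B \<inter> space M | B. B \<in> sets borel})"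
      using indep 1 2 unfolding indep_sets2_eq by blast
  qed
  note prod = indep_var_integrable[OF iv e_int f(2)] indep_var_lebesgue_integral[OF iv e_int f(2)]
  \<comment> \<open>Valid on \<open>space M\<close> only, where \<open>R\<close> takes a value in
    \<open>A\<close> and exactly one indicator equals 1.\<close>
  have eq: "f (R \<omega>) \<omega> = (\<Sum>k\<in>A. e k \<omega> * f k \<omega>)" if "\<omega> \<in> space M" for \<omega>
    using measurable_space[OF R that] A(1)
    by (simp add: e_def indicator_def if_distrib[where f="\<lambda>x. x * _"] sum.If_cases)
  show "integrable M (\<lambda>\<omega>. f (R \<omega>) \<omega>)"
    by (subst Bochner_Integration.integrable_cong[OF refl eq]) (auto intro: prod(1))
  have "expectation (\<lambda>\<omega>. f (R \<omega>) \<omega>) = (\<Sum>k\<in>A. expectation (\<lambda>\<omega>. e k \<omega> * f k \<omega>))"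
    by (subst Bochner_Integration.integral_cong[OF refl eq]) (auto intro!: Bochner_Integration.integral_sum prod(1))
  also have "\<dots> = (\<Sum>k\<in>A. expectation (f k)) / real (card A)"
    by (simp add: prod(2) prob sum_divide_distrib)
  finally show "expectation (\<lambda>\<omega>. f (R \<omega>) \<omega>) = (\<Sum>k\<in>A. expectation (f k)) / real (card A)" .
qed

section \<open>Smooth objectives\<close>

locale smooth_objective =
  fixes G :: "real ^ 'd \<Rightarrow> real" and gradG :: "real ^ 'd \<Rightarrow> real ^ 'd"
    and L :: real and \<theta>star :: "real ^ 'd"
  assumes gderiv: "GDERIV G x :> gradG x"
    and L_pos: "L > 0"
    and lipschitz: "norm (gradG x - gradG y) \<le> L * norm (x - y)"
    and minimizer: "G \<theta>star \<le> G x"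
begin

text \<open>Restricted to the segment from x to y, \<open>G\<close> minus its linear part and the
  quadratic \<open>L / 2 * t\<^sup>2 * (norm h)\<^sup>2\<close> is the function
  \<open>\<phi>\<close>. By the Lipschitz condition the gradient changes by at most L t |h| along
  the segment, so the derivative of \<open>\<phi>\<close> is nonpositive, and
  \<open>\<phi> 1 \<le> \<phi> 0\<close> is the claim.\<close>

lemma descent: "G y \<le> G x + gradG x \<bullet> (y - x) + L / 2 * (norm (y - x))\<^sup>2"
proof -
  define h where "h = y - x"
  define \<phi> where "\<phi> t = G (x + t *\<^sub>R h) - t * (gradG x \<bullet> h) - L / 2 * t\<^sup>2 * (norm h)\<^sup>2" for t :: real
  have "\<phi> 1 \<le> \<phi> 0"
  proof (rule DERIV_nonpos_imp_nonincreasing[where f=\<phi>])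
    fix t :: real assume t: "0 \<le> t" "t \<le> 1"
    have "((\<lambda>t. G (x + t *\<^sub>R h)) has_derivative (\<lambda>s. (s *\<^sub>R h) \<bullet> gradG (x + t *\<^sub>R h))) (at t)"
      by (rule has_derivative_compose[of "\<lambda>t. x + t *\<^sub>R h" "\<lambda>s. s *\<^sub>R h" _ _ G])
         (use gderiv[unfolded gderiv_def] in \<open>auto intro!: derivative_eq_intros\<close>)
    then have "((\<lambda>t. G (x + t *\<^sub>R h)) has_real_derivative (gradG (x + t *\<^sub>R h) \<bullet> h)) (at t)"
      unfolding has_field_derivative_def by (rule has_derivative_eq_rhs) (simp add: fun_eq_iff inner_commute)
    then have "(\<phi> has_real_derivative
        (gradG (x + t *\<^sub>R h) \<bullet> h - gradG x \<bullet> h - L * t * (norm h)\<^sup>2)) (at t)"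
      unfolding \<phi>_def by (auto intro!: derivative_eq_intros)
    moreover have "gradG (x + t *\<^sub>R h) \<bullet> h - gradG x \<bullet> h \<le> L * t * (norm h)\<^sup>2"
    proof -
      have "gradG (x + t *\<^sub>R h) \<bullet> h - gradG x \<bullet> h = (gradG (x + t *\<^sub>R h) - gradG x) \<bullet> h"
        by (simp add: inner_diff_left)
      also have "\<dots> \<le> norm (gradG (x + t *\<^sub>R h) - gradG x) * norm h"
        by (rule norm_cauchy_schwarz)
      also have "\<dots> \<le> L * norm (x + t *\<^sub>R h - x) * norm h"
        by (intro mult_right_mono lipschitz) auto
      finally show ?thesis
        using t by (simp add: power2_eq_square mult.assoc)
    qed
    ultimately show "\<exists>d. (\<phi> has_real_derivative d) (at t) \<and> d \<le> 0"
      by force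
  qed simp
  then show ?thesis
    by (simp add: \<phi>_def h_def)
qed

section \<open>Measurability, growth bounds and transfer of square-integrability\<close>

lemma borel_measurable_G [measurable]: "G \<in> borel_measurable borel"
proof (rule borel_measurable_continuous_onI)
  show "continuous_on UNIV G"
    using gderiv[unfolded gderiv_def] has_derivative_continuous
    by (blast intro: continuous_at_imp_continuous_on)
qed

lemma borel_measurable_gradG [measurable]: "gradG \<in> borel_measurable borel"
proof (rule borel_measurable_continuous_onI)
  have "L-lipschitz_on UNIV gradG"
    using L_pos lipschitz by (auto simp: lipschitz_on_def dist_norm)
  then show "continuous_on UNIV gradG"
    by (rule lipschitz_on_continuous_on)
qed

lemma norm_gradG_squared_le: "(norm (gradG x))\<^sup>2 \<le> 2 * (norm (gradG 0))\<^sup>2 + 2 * (L * norm x)\<^sup>2"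
proof -
  have "(norm (gradG 0 + (gradG x - gradG 0)))\<^sup>2
      \<le> 2 * (norm (gradG 0))\<^sup>2 + 2 * (norm (gradG x - gradG 0))\<^sup>2"
    by (rule norm_add_squared_le)
  also have "\<dots> \<le> 2 * (norm (gradG 0))\<^sup>2 + 2 * (L * norm x)\<^sup>2"
    using lipschitz[of x 0] by (intro add_left_mono mult_left_mono power_mono) auto
  finally show ?thesis
    by simp
qed

text \<open>From above, \<open>descent\<close> at the origin gives a quadratic; from below, the
  minimum value is a bound. Adding the absolute values of both covers either sign of
  \<open>G x\<close>.\<close>

lemma abs_G_le:
  "\<bar>G x\<bar> \<le> \<bar>G \<theta>star\<bar> + \<bar>G 0\<bar> + (norm (gradG 0))\<^sup>2 + (1 + L / 2) * (norm x)\<^sup>2"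
proof -
  have "G x \<le> G 0 + gradG 0 \<bullet> x + L / 2 * (norm x)\<^sup>2"
    using descent[of x 0] by simp
  moreover have "0 \<le> L / 2 * (norm x)\<^sup>2"
    using L_pos by simp
  ultimately show ?thesis
    using minimizer[of x] abs_inner_le_sum_squares[of "gradG 0" x] zero_le_power2[of "norm x"]
      zero_le_power2[of "norm (gradG 0)"]
    by (simp add: algebra_simps)
qed

lemma integrable_gradG_squared:
  assumes "finite_measure M" and [measurable]: "X \<in> borel_measurable M"
    and "integrable M (\<lambda>\<omega>. (norm (X \<omega>))\<^sup>2)"
  shows "integrable M (\<lambda>\<omega>. (norm (gradG (X \<omega>)))\<^sup>2)"
proof (rule Bochner_Integration.integrable_bound)
  interpret finite_measure M by fact
  show "integrable M (\<lambda>\<omega>. 2 * (norm (gradG 0))\<^sup>2 + 2 * (L * norm (X \<omega>))\<^sup>2)"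
    using assms(3) by (auto simp: power_mult_distrib)
qed (auto intro!: norm_gradG_squared_le order_trans[OF _ abs_ge_self])

lemma integrable_G:
  assumes "finite_measure M" and [measurable]: "X \<in> borel_measurable M"
    and "integrable M (\<lambda>\<omega>. (norm (X \<omega>))\<^sup>2)"
  shows "integrable M (\<lambda>\<omega>. G (X \<omega>))"
proof (rule Bochner_Integration.integrable_bound)
  interpret finite_measure M by fact
  show "integrable M (\<lambda>\<omega>. \<bar>G \<theta>star\<bar> + \<bar>G 0\<bar> + (norm (gradG 0))\<^sup>2 + (1 + L / 2) * (norm (X \<omega>))\<^sup>2)"
    using assms(3) by auto
qed (auto intro!: abs_G_le order_trans[OF _ abs_ge_self])

end

section \<open>The stochastic gradient recursion\<close>

text \<open>Both step-size rules are constant in k, so the step size is a single real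
  \<open>z\<close>. Bias and moment conditions stay outside, since the two parts share only what is
  fixed here. The recursion runs n times and ends at \<open>Suc n\<close>, one index beyond the
  range of \<open>R\<close>.\<close>

locale stochastic_gradient = prob_space M + smooth_objective G gradG L \<theta>star
  for M :: "'w measure" and G :: "real ^ 'd \<Rightarrow> real" and gradG L \<theta>star +
  fixes \<theta>init :: "real ^ 'd" and n :: nat and z :: real
    and \<theta> g :: "nat \<Rightarrow> 'w \<Rightarrow> real ^ 'd" and R :: "'w \<Rightarrow> nat"
  assumes n_pos: "n \<ge> 1"
    and g_meas: "k \<in> {1..n} \<Longrightarrow> g k \<in> borel_measurable M"
    and start: "\<omega> \<in> space M \<Longrightarrow> \<theta> 1 \<omega> = \<theta>init"
    and step: "k \<in> {1..n} \<Longrightarrow> \<omega> \<in> space M \<Longrightarrow> \<theta> (Suc k) \<omega> = \<theta> k \<omega> - z *\<^sub>R g k \<omega>"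
    and R_meas: "R \<in> measurable M (count_space {1..n})"
    and R_uniform: "distr M (count_space {1..n}) R = uniform_count_measure {1..n}"
    and R_indep: "indep_set (sets (sigma_of M {R}))
           (sets (sigma_of M (\<theta> ` {1..Suc n} \<union> g ` {1..n})))"
begin

abbreviation filtration :: "nat \<Rightarrow> 'w measure" where
  "filtration k \<equiv> sigma_of M (\<theta> ` {1..k})"

section \<open>Measurability and second moments of the iterates\<close>

lemma iterate_meas: "k \<in> {1..Suc n} \<Longrightarrow> \<theta> k \<in> borel_measurable M"
proof (induction k)
  case (Suc k)
  show ?case
  \<comment> \<open>Index 0 lies outside the range, so the genuine base case of the induction is
    \<open>Suc 0\<close>, where the iterate is constant on \<open>space M\<close>.\<close>
  proof (cases "k = 0")
    case True
    then show ?thesis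
      using start by (subst measurable_cong[where g="\<lambda>_. \<theta>init"]) auto
  next
    case False
    with Suc have k: "k \<in> {1..n}" and [measurable]: "\<theta> k \<in> borel_measurable M"
      by auto
    note g_meas[OF k, measurable]
    show ?thesis
      using step[OF k] by (subst measurable_cong[where g="\<lambda>\<omega>. \<theta> k \<omega> - z *\<^sub>R g k \<omega>"]) auto
  qed
qed simp

lemma start_integrable: "integrable M (\<lambda>\<omega>. (norm (\<theta> 1 \<omega>))\<^sup>2)"
  by (subst Bochner_Integration.integrable_cong[OF refl, where g="\<lambda>_. (norm \<theta>init)\<^sup>2"])
     (use start in auto)

lemma iterate_step_integrable:
  assumes k: "k \<in> {1..n}"
    and int: "integrable M (\<lambda>\<omega>. (norm (\<theta> k \<omega>))\<^sup>2)" "integrable M (\<lambda>\<omega>. (norm (g k \<omega>))\<^sup>2)"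
  shows "integrable M (\<lambda>\<omega>. (norm (\<theta> (Suc k) \<omega>))\<^sup>2)"
proof -
  have [measurable]: "\<theta> k \<in> borel_measurable M" "g k \<in> borel_measurable M"
    using k iterate_meas g_meas by auto
  have "integrable M (\<lambda>\<omega>. (norm (\<theta> k \<omega> + (- z) *\<^sub>R g k \<omega>))\<^sup>2)"
    by (rule integrable_norm_add_squared) (use int in \<open>auto simp: power_mult_distrib\<close>)
  then show ?thesis
    by (subst Bochner_Integration.integrable_cong[OF refl]) (use step[OF k] in auto)
qed

lemma iterate_integrable:
  assumes g: "\<And>j. j \<in> {1..n} \<Longrightarrow> integrable M (\<lambda>\<omega>. (norm (g j \<omega>))\<^sup>2)"
  shows "k \<in> {1..Suc n} \<Longrightarrow> integrable M (\<lambda>\<omega>. (norm (\<theta> k \<omega>))\<^sup>2)"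
proof (induction k)
  case (Suc k)
  show ?case
  proof (cases "k = 0")
    case True
    then show ?thesis
      using start_integrable by simp
  next
    case False
    with Suc have "k \<in> {1..n}"
      by auto
    with Suc show ?thesis
      by (intro iterate_step_integrable g) auto
  qed
qed simp

lemma noise_imp_gradient_integrable:
  assumes k: "k \<in> {1..n}" and \<theta>k: "integrable M (\<lambda>\<omega>. (norm (\<theta> k \<omega>))\<^sup>2)"
    and noise: "integrable M (\<lambda>\<omega>. (norm (g k \<omega> - gradG (\<theta> k \<omega>)))\<^sup>2)"
  shows "integrable M (\<lambda>\<omega>. (norm (g k \<omega>))\<^sup>2)"
proof -
  have [measurable]: "\<theta> k \<in> borel_measurable M" "g k \<in> borel_measurable M"
    using k iterate_meas g_meas by auto
  have "integrable M (\<lambda>\<omega>. (norm ((g k \<omega> - gradG (\<theta> k \<omega>)) + gradG (\<theta> k \<omega>)))\<^sup>2)"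
    by (rule integrable_norm_add_squared)
       (use noise integrable_gradG_squared[OF finite_measure_axioms _ \<theta>k] in auto)
  then show ?thesis
    by simp
qed

text \<open>When only the noise is known to be square-integrable, the moments are obtained by a
  joint induction: \<open>\<theta> k\<close> in L2 gives \<open>gradG (\<theta> k)\<close> in L2 by
  linear growth, adding the noise gives \<open>g k\<close>, and the recursion gives
  \<open>\<theta> (Suc k)\<close>. \<open>iterate_integrable\<close> cannot be used here, because it
  presupposes the moments of all \<open>g j\<close>.\<close>

lemma gradient_integrable_of_noise:
  assumes noise: "\<And>j. j \<in> {1..n} \<Longrightarrow> integrable M (\<lambda>\<omega>. (norm (g j \<omega> - gradG (\<theta> j \<omega>)))\<^sup>2)"
    and k: "k \<in> {1..n}"
  shows "integrable M (\<lambda>\<omega>. (norm (g k \<omega>))\<^sup>2)"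
proof -
  have "k \<in> {1..n} \<longrightarrow> integrable M (\<lambda>\<omega>. (norm (\<theta> k \<omega>))\<^sup>2)" for k
  proof (induction k)
    case (Suc k)
    then show ?case
      using start_integrable
      by (cases "k = 0") (auto intro!: iterate_step_integrable noise_imp_gradient_integrable noise)
  qed simp
  with k noise show ?thesis
    by (intro noise_imp_gradient_integrable) auto
qed

section \<open>Tower property, expected descent and the resulting bounds\<close>

lemma filtration_subalgebra: "k \<in> {1..Suc n} \<Longrightarrow> subalgebra M (filtration k)"
  by (rule subalgebra_sigma_of) (auto intro!: iterate_meas)

lemma tower_inner:
  assumes k: "k \<in> {1..n}"
    and g: "\<And>j. j \<in> {1..n} \<Longrightarrow> integrable M (\<lambda>\<omega>. (norm (g j \<omega>))\<^sup>2)"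
  shows "integrable M (\<lambda>\<omega>. gradG (\<theta> k \<omega>) \<bullet> vec_cond_exp M (filtration k) (g k) \<omega>)"
    and "expectation (\<lambda>\<omega>. gradG (\<theta> k \<omega>) \<bullet> vec_cond_exp M (filtration k) (g k) \<omega>)
      = expectation (\<lambda>\<omega>. gradG (\<theta> k \<omega>) \<bullet> g k \<omega>)"
proof -
  have "subalgebra M (filtration k)"
    using k by (intro filtration_subalgebra) auto
  then interpret finite_measure_subalgebra M "filtration k"
    by unfold_locales
  \<comment> \<open>The current iterate is among the generators of \<open>filtration k\<close>,
    which makes its gradient a factor known to the past.\<close>
  have "\<theta> k \<in> borel_measurable (filtration k)"
    using k by (intro measurable_sigma_of) auto
  then have F: "(\<lambda>\<omega>. gradG (\<theta> k \<omega>)) \<in> borel_measurable (filtration k)"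
    by measurable
  have int: "integrable M (\<lambda>\<omega>. (norm (gradG (\<theta> k \<omega>)))\<^sup>2)"
    using k by (intro integrable_gradG_squared finite_measure_axioms iterate_meas iterate_integrable g) auto
  note vec_cond_exp_inner[OF F g_meas[OF k] int g[OF k]]
  then show "integrable M (\<lambda>\<omega>. gradG (\<theta> k \<omega>) \<bullet> vec_cond_exp M (filtration k) (g k) \<omega>)"
    and "expectation (\<lambda>\<omega>. gradG (\<theta> k \<omega>) \<bullet> vec_cond_exp M (filtration k) (g k) \<omega>)
      = expectation (\<lambda>\<omega>. gradG (\<theta> k \<omega>) \<bullet> g k \<omega>)"
    by auto
qed

lemma iterate_functionals_integrable:
  assumes g: "\<And>j. j \<in> {1..n} \<Longrightarrow> integrable M (\<lambda>\<omega>. (norm (g j \<omega>))\<^sup>2)"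
    and k: "k \<in> {1..Suc n}"
  shows "integrable M (\<lambda>\<omega>. G (\<theta> k \<omega>))" "integrable M (\<lambda>\<omega>. (norm (gradG (\<theta> k \<omega>)))\<^sup>2)"
  using k by (auto intro!: integrable_G integrable_gradG_squared finite_measure_axioms iterate_meas
      iterate_integrable g)

lemma inner_integrable:
  assumes g: "\<And>j. j \<in> {1..n} \<Longrightarrow> integrable M (\<lambda>\<omega>. (norm (g j \<omega>))\<^sup>2)"
    and k: "k \<in> {1..n}"
  shows "integrable M (\<lambda>\<omega>. gradG (\<theta> k \<omega>) \<bullet> g k \<omega>)"
proof -
  have [measurable]: "\<theta> k \<in> borel_measurable M" "g k \<in> borel_measurable M"
    using k iterate_meas g_meas by auto
  show ?thesis
    using k by (intro integrable_inner_of_squares iterate_functionals_integrable g) auto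
qed

text \<open>The inner product is stated with the conditional expectation rather than
  \<open>g k\<close>, because both the unbiased and the biased hypothesis speak about the
  former.\<close>

lemma expected_descent:
  assumes g: "\<And>j. j \<in> {1..n} \<Longrightarrow> integrable M (\<lambda>\<omega>. (norm (g j \<omega>))\<^sup>2)"
    and k: "k \<in> {1..n}"
  shows "expectation (\<lambda>\<omega>. G (\<theta> (Suc k) \<omega>)) \<le> expectation (\<lambda>\<omega>. G (\<theta> k \<omega>))
    - z * expectation (\<lambda>\<omega>. gradG (\<theta> k \<omega>) \<bullet> vec_cond_exp M (filtration k) (g k) \<omega>)
    + L / 2 * z\<^sup>2 * expectation (\<lambda>\<omega>. (norm (g k \<omega>))\<^sup>2)"
proof -
  have int: "integrable M (\<lambda>\<omega>. G (\<theta> k \<omega>))" "integrable M (\<lambda>\<omega>. G (\<theta> (Suc k) \<omega>))"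
    "integrable M (\<lambda>\<omega>. gradG (\<theta> k \<omega>) \<bullet> g k \<omega>)"
    using k by (auto intro!: iterate_functionals_integrable inner_integrable g)
  have "G (\<theta> (Suc k) \<omega>) \<le> G (\<theta> k \<omega>) - z * (gradG (\<theta> k \<omega>) \<bullet> g k \<omega>)
      + L / 2 * z\<^sup>2 * (norm (g k \<omega>))\<^sup>2" if "\<omega> \<in> space M" for \<omega>
    using descent[of "\<theta> (Suc k) \<omega>" "\<theta> k \<omega>"] step[OF k that]
    by (simp add: power_mult_distrib)
  then have "expectation (\<lambda>\<omega>. G (\<theta> (Suc k) \<omega>)) \<le> expectation (\<lambda>\<omega>. G (\<theta> k \<omega>)
      - z * (gradG (\<theta> k \<omega>) \<bullet> g k \<omega>) + L / 2 * z\<^sup>2 * (norm (g k \<omega>))\<^sup>2)"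
    using int g[OF k] by (intro integral_mono) auto
  also have "\<dots> = expectation (\<lambda>\<omega>. G (\<theta> k \<omega>)) - z * expectation (\<lambda>\<omega>. gradG (\<theta> k \<omega>) \<bullet> g k \<omega>)
      + L / 2 * z\<^sup>2 * expectation (\<lambda>\<omega>. (norm (g k \<omega>))\<^sup>2)"
    using int g[OF k] by simp
  finally show ?thesis
    using tower_inner(2)[OF k g] by simp
qed

text \<open>The common end of both parts: \<open>a\<close> is the share of the descent term kept in
  each step (z/2 or z) and \<open>c\<close> the error per step. Summing telescopes the values of
  \<open>G\<close>, and dividing by \<open>n * a\<close> turns the sum into the average seen by
  \<open>R\<close>.\<close>

lemma random_iterate_bound:
  assumes g: "\<And>j. j \<in> {1..n} \<Longrightarrow> integrable M (\<lambda>\<omega>. (norm (g j \<omega>))\<^sup>2)"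
    and a: "a > 0"
    and decrease: "\<And>k. k \<in> {1..n} \<Longrightarrow> a * expectation (\<lambda>\<omega>. (norm (gradG (\<theta> k \<omega>)))\<^sup>2)
      \<le> expectation (\<lambda>\<omega>. G (\<theta> k \<omega>)) - expectation (\<lambda>\<omega>. G (\<theta> (Suc k) \<omega>)) + c"
  shows "integrable M (\<lambda>\<omega>. (norm (gradG (\<theta> (R \<omega>) \<omega>)))\<^sup>2)"
    and "expectation (\<lambda>\<omega>. (norm (gradG (\<theta> (R \<omega>) \<omega>)))\<^sup>2) \<le> (G \<theta>init - G \<theta>star) / (real n * a) + c / a"
proof -
  let ?F = "sigma_of M (\<theta> ` {1..Suc n} \<union> g ` {1..n})"
  have F: "subalgebra M ?F"
    by (rule subalgebra_sigma_of) (use iterate_meas g_meas in auto)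
  have meas: "(\<lambda>\<omega>. (norm (gradG (\<theta> k \<omega>)))\<^sup>2) \<in> borel_measurable ?F" if "k \<in> {1..n}" for k
  proof -
    have "\<theta> k \<in> borel_measurable ?F"
      using that by (intro measurable_sigma_of) auto
    then show ?thesis
      by measurable
  qed
  note avg = uniform_index_expectation[OF _ _ _ R_meas R_uniform F R_indep,
      of "\<lambda>k \<omega>. (norm (gradG (\<theta> k \<omega>)))\<^sup>2"]
  show "integrable M (\<lambda>\<omega>. (norm (gradG (\<theta> (R \<omega>) \<omega>)))\<^sup>2)"
    using n_pos by (intro avg(1) meas iterate_functionals_integrable g) auto
  have avg_eq: "expectation (\<lambda>\<omega>. (norm (gradG (\<theta> (R \<omega>) \<omega>)))\<^sup>2)
      = (\<Sum>k=1..n. expectation (\<lambda>\<omega>. (norm (gradG (\<theta> k \<omega>)))\<^sup>2)) / real n"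
    using n_pos avg(2)[OF _ _ _ meas iterate_functionals_integrable(2)[OF g]] by simp
  have "a * (\<Sum>k=1..n. expectation (\<lambda>\<omega>. (norm (gradG (\<theta> k \<omega>)))\<^sup>2))
      \<le> (\<Sum>k=1..n. expectation (\<lambda>\<omega>. G (\<theta> k \<omega>)) - expectation (\<lambda>\<omega>. G (\<theta> (Suc k) \<omega>)) + c)"
    unfolding sum_distrib_left by (intro sum_mono decrease)
  also have "\<dots> = expectation (\<lambda>\<omega>. G (\<theta> 1 \<omega>)) - expectation (\<lambda>\<omega>. G (\<theta> (Suc n) \<omega>)) + real n * c"
    \<comment> \<open>The negated sequence is used because the library sum has the successor term
      first.\<close>
    using sum_Suc_diff[of 1 n "\<lambda>k. - expectation (\<lambda>\<omega>. G (\<theta> k \<omega>))"] n_pos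
    by (simp add: sum.distrib)
  also have "expectation (\<lambda>\<omega>. G (\<theta> 1 \<omega>)) = G \<theta>init"
    by (subst Bochner_Integration.integral_cong[OF refl, where g="\<lambda>_. G \<theta>init"])
       (use start in \<open>auto simp: prob_space\<close>)
  finally have telescoped: "a * (\<Sum>k=1..n. expectation (\<lambda>\<omega>. (norm (gradG (\<theta> k \<omega>)))\<^sup>2))
      \<le> G \<theta>init - expectation (\<lambda>\<omega>. G (\<theta> (Suc n) \<omega>)) + real n * c" .
  have "G \<theta>star \<le> expectation (\<lambda>\<omega>. G (\<theta> (Suc n) \<omega>))"
    using n_pos by (intro integral_ge_const iterate_functionals_integrable g) (auto simp: minimizer)
  with telescoped have "a * (\<Sum>k=1..n. expectation (\<lambda>\<omega>. (norm (gradG (\<theta> k \<omega>)))\<^sup>2))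
      \<le> G \<theta>init - G \<theta>star + real n * c"
    by linarith
  then show "expectation (\<lambda>\<omega>. (norm (gradG (\<theta> (R \<omega>) \<omega>)))\<^sup>2)
      \<le> (G \<theta>init - G \<theta>star) / (real n * a) + c / a"
    unfolding avg_eq using a n_pos by (simp add: field_simps)
qed

text \<open>The bias-variance identity bounds the second moment of \<open>g k\<close> by the
  expected squared gradient plus \<open>v\<close>. The condition \<open>z \<le> 1 / L\<close> keeps
  the gradient part of the quadratic error below half of the descent term.\<close>

lemma unbiased_bound:
  assumes unbiased: "\<And>k. k \<in> {1..n} \<Longrightarrow>
      AE \<omega> in M. vec_cond_exp M (filtration k) (g k) \<omega> = gradG (\<theta> k \<omega>)"
    and noise: "\<And>k. k \<in> {1..n} \<Longrightarrow> integrable M (\<lambda>\<omega>. (norm (g k \<omega> - gradG (\<theta> k \<omega>)))\<^sup>2)"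
      "\<And>k. k \<in> {1..n} \<Longrightarrow> expectation (\<lambda>\<omega>. (norm (g k \<omega> - gradG (\<theta> k \<omega>)))\<^sup>2) \<le> v"
    and z: "0 < z" "z \<le> 1 / L"
  shows "integrable M (\<lambda>\<omega>. (norm (gradG (\<theta> (R \<omega>) \<omega>)))\<^sup>2)"
    and "expectation (\<lambda>\<omega>. (norm (gradG (\<theta> (R \<omega>) \<omega>)))\<^sup>2)
      \<le> 2 * (G \<theta>init - G \<theta>star) / (real n * z) + L * z * v"
proof -
  have g: "integrable M (\<lambda>\<omega>. (norm (g k \<omega>))\<^sup>2)" if "k \<in> {1..n}" for k
    using gradient_integrable_of_noise[OF noise(1) that] by simp
  have decrease: "z / 2 * expectation (\<lambda>\<omega>. (norm (gradG (\<theta> k \<omega>)))\<^sup>2)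
      \<le> expectation (\<lambda>\<omega>. G (\<theta> k \<omega>)) - expectation (\<lambda>\<omega>. G (\<theta> (Suc k) \<omega>)) + L / 2 * z\<^sup>2 * v"
    if k: "k \<in> {1..n}" for k
  proof -
    let ?D = "expectation (\<lambda>\<omega>. (norm (gradG (\<theta> k \<omega>)))\<^sup>2)"
    let ?g = "expectation (\<lambda>\<omega>. (norm (g k \<omega>))\<^sup>2)"
    have [measurable]: "\<theta> k \<in> borel_measurable M" "g k \<in> borel_measurable M"
      using k iterate_meas g_meas by auto
    have int: "integrable M (\<lambda>\<omega>. (norm (gradG (\<theta> k \<omega>)))\<^sup>2)"
      "integrable M (\<lambda>\<omega>. gradG (\<theta> k \<omega>) \<bullet> g k \<omega>)"
      using k by (auto intro!: iterate_functionals_integrable inner_integrable g)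
    have cross: "expectation (\<lambda>\<omega>. gradG (\<theta> k \<omega>) \<bullet> vec_cond_exp M (filtration k) (g k) \<omega>) = ?D"
      by (rule integral_cong_AE)
         (use unbiased[OF k] borel_measurable_integrable[OF tower_inner(1)[OF k g]] in
           \<open>auto simp: power2_norm_eq_inner\<close>)
    have "expectation (\<lambda>\<omega>. (norm (g k \<omega> - gradG (\<theta> k \<omega>)))\<^sup>2)
        = expectation (\<lambda>\<omega>. (norm (g k \<omega>))\<^sup>2 - 2 * (gradG (\<theta> k \<omega>) \<bullet> g k \<omega>) + (norm (gradG (\<theta> k \<omega>)))\<^sup>2)"
      by (intro Bochner_Integration.integral_cong refl)
         (simp add: power2_norm_eq_inner inner_diff inner_commute)
    \<comment> \<open>By the tower property and unbiasedness the cross term contributes -2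
      \<open>?D\<close>, which with the last square leaves -\<open>?D\<close>.\<close>
    also have "\<dots> = ?g - ?D"
      using int g[OF k] trans[OF tower_inner(2)[OF k g, symmetric] cross] by simp
    finally have "?g \<le> ?D + v"
      using noise(2)[OF k] by simp
    then have "L / 2 * z\<^sup>2 * ?g \<le> L / 2 * z\<^sup>2 * (?D + v)"
      using L_pos by (intro mult_left_mono) auto
    moreover have "L * z * (z / 2 * ?D) \<le> 1 * (z / 2 * ?D)"
      using z L_pos by (intro mult_right_mono mult_nonneg_nonneg) (auto simp: field_simps)
    ultimately show ?thesis
      using expected_descent[OF g k] unfolding cross by (simp add: algebra_simps power2_eq_square)
  qed
  have half: "z / 2 > 0"
    using z by simp
  note bound = random_iterate_bound[OF g half decrease]
  show "integrable M (\<lambda>\<omega>. (norm (gradG (\<theta> (R \<omega>) \<omega>)))\<^sup>2)"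
    by (rule bound(1))
  show "expectation (\<lambda>\<omega>. (norm (gradG (\<theta> (R \<omega>) \<omega>)))\<^sup>2)
      \<le> 2 * (G \<theta>init - G \<theta>star) / (real n * z) + L * z * v"
    using bound(2) z n_pos by (simp add: field_simps power2_eq_square)
qed

text \<open>Replacing the conditional expectation by the true gradient costs at most
  \<open>B * b\<close> by Cauchy-Schwarz. As \<open>s\<close> bounds the second moment of
  \<open>g k\<close> outright, nothing has to be absorbed and \<open>z\<close> needs only to be
  positive.\<close>

lemma biased_bound:
  assumes bias: "\<And>k. k \<in> {1..n} \<Longrightarrow>
      AE \<omega> in M. norm (vec_cond_exp M (filtration k) (g k) \<omega> - gradG (\<theta> k \<omega>)) \<le> b"
    and g: "\<And>k. k \<in> {1..n} \<Longrightarrow> integrable M (\<lambda>\<omega>. (norm (g k \<omega>))\<^sup>2)"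
      "\<And>k. k \<in> {1..n} \<Longrightarrow> expectation (\<lambda>\<omega>. (norm (g k \<omega>))\<^sup>2) \<le> s"
    and grad: "\<And>x. norm (gradG x) \<le> B"
    and z: "0 < z"
  shows "integrable M (\<lambda>\<omega>. (norm (gradG (\<theta> (R \<omega>) \<omega>)))\<^sup>2)"
    and "expectation (\<lambda>\<omega>. (norm (gradG (\<theta> (R \<omega>) \<omega>)))\<^sup>2)
      \<le> (G \<theta>init - G \<theta>star) / (real n * z) + B * b + L / 2 * z * s"
proof -
  have decrease: "z * expectation (\<lambda>\<omega>. (norm (gradG (\<theta> k \<omega>)))\<^sup>2)
      \<le> expectation (\<lambda>\<omega>. G (\<theta> k \<omega>)) - expectation (\<lambda>\<omega>. G (\<theta> (Suc k) \<omega>)) + z * (B * b + L / 2 * z * s)"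
    if k: "k \<in> {1..n}" for k
  proof -
    let ?c = "vec_cond_exp M (filtration k) (g k)"
    let ?D = "expectation (\<lambda>\<omega>. (norm (gradG (\<theta> k \<omega>)))\<^sup>2)"
    have int: "integrable M (\<lambda>\<omega>. (norm (gradG (\<theta> k \<omega>)))\<^sup>2)"
      using k by (auto intro!: iterate_functionals_integrable g)
    have "AE \<omega> in M. (norm (gradG (\<theta> k \<omega>)))\<^sup>2 \<le> gradG (\<theta> k \<omega>) \<bullet> ?c \<omega> + B * b"
      using bias[OF k]
    proof eventually_elim
      case (elim \<omega>)
      have "(norm (gradG (\<theta> k \<omega>)))\<^sup>2 - gradG (\<theta> k \<omega>) \<bullet> ?c \<omega>
          = gradG (\<theta> k \<omega>) \<bullet> (gradG (\<theta> k \<omega>) - ?c \<omega>)"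
        by (simp add: power2_norm_eq_inner inner_diff_right)
      also have "\<dots> \<le> norm (gradG (\<theta> k \<omega>)) * norm (gradG (\<theta> k \<omega>) - ?c \<omega>)"
        by (rule norm_cauchy_schwarz)
      also have "\<dots> \<le> B * b"
        using elim grad[of "\<theta> k \<omega>"] order_trans[OF norm_ge_zero grad]
        by (intro mult_mono) (auto simp: norm_minus_commute)
      finally show ?case
        by simp
    qed
    then have "?D \<le> expectation (\<lambda>\<omega>. gradG (\<theta> k \<omega>) \<bullet> ?c \<omega> + B * b)"
      using int tower_inner(1)[OF k g(1)] by (intro integral_mono_AE) auto
    also have "\<dots> = expectation (\<lambda>\<omega>. gradG (\<theta> k \<omega>) \<bullet> ?c \<omega>) + B * b"
      using tower_inner(1)[OF k g(1)] by (simp add: prob_space)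
    finally have "z * ?D \<le> z * (expectation (\<lambda>\<omega>. gradG (\<theta> k \<omega>) \<bullet> ?c \<omega>) + B * b)"
      using z by (intro mult_left_mono) auto
    moreover have "L / 2 * z\<^sup>2 * expectation (\<lambda>\<omega>. (norm (g k \<omega>))\<^sup>2) \<le> L / 2 * z\<^sup>2 * s"
      using L_pos g(2)[OF k] by (intro mult_left_mono) auto
    ultimately show ?thesis
      using expected_descent[OF g(1) k] by (simp add: algebra_simps power2_eq_square)
  qed
  note bound = random_iterate_bound[OF g(1) z decrease]
  show "integrable M (\<lambda>\<omega>. (norm (gradG (\<theta> (R \<omega>) \<omega>)))\<^sup>2)"
    by (rule bound(1))
  show "expectation (\<lambda>\<omega>. (norm (gradG (\<theta> (R \<omega>) \<omega>)))\<^sup>2)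
      \<le> (G \<theta>init - G \<theta>star) / (real n * z) + B * b + L / 2 * z * s"
    using bound(2) z by (simp add: add.assoc)
qed

end

section \<open>Step sizes\<close>

theorem theorem5p2:
  fixes M :: "'w measure"
    and G :: "real ^ 'd \<Rightarrow> real" and gradG :: "real ^ 'd \<Rightarrow> real ^ 'd"
    and L1 :: real and \<theta>star \<theta>init :: "real ^ 'd"
    and n :: nat and \<zeta> :: "nat \<Rightarrow> real"
    and \<theta> g :: "nat \<Rightarrow> 'w \<Rightarrow> real ^ 'd" and R :: "'w \<Rightarrow> nat"
  assumes "prob_space M"
    and "\<forall>x. GDERIV G x :> gradG x"
    and "L1 > 0"
    and "\<forall>x y. norm (gradG x - gradG y) \<le> L1 * norm (x - y)"
    and "\<forall>x. G \<theta>star \<le> G x"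
    and "n \<ge> 1"
    and "\<forall>k\<in>{1..n}. g k \<in> borel_measurable M"
    and "\<forall>\<omega>\<in>space M. \<theta> 1 \<omega> = \<theta>init"
    and "\<forall>k\<in>{1..n}. \<forall>\<omega>\<in>space M. \<theta> (Suc k) \<omega> = \<theta> k \<omega> - \<zeta> k *\<^sub>R g k \<omega>"
    and "R \<in> measurable M (count_space {1..n})"
    and "distr M (count_space {1..n}) R = uniform_count_measure {1..n}"
    and "prob_space.indep_set M (sets (sigma_of M {R}))
           (sets (sigma_of M (\<theta> ` {1..Suc n} \<union> g ` {1..n})))"
  shows "(\<forall>\<sigma>::real.
            (\<forall>k\<in>{1..n}. AE \<omega> in M.
               vec_cond_exp M (sigma_of M (\<theta> ` {1..k})) (g k) \<omega> = gradG (\<theta> k \<omega>)) \<longrightarrow>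
            (\<forall>k\<in>{1..n}. integrable M (\<lambda>\<omega>. (norm (g k \<omega> - gradG (\<theta> k \<omega>)))\<^sup>2) \<and>
               (\<integral>\<omega>. (norm (g k \<omega> - gradG (\<theta> k \<omega>)))\<^sup>2 \<partial>M) \<le> \<sigma>\<^sup>2) \<longrightarrow>
            (\<forall>k\<in>{1..n}. \<zeta> k = min (1 / L1) (1 / sqrt (real n))) \<longrightarrow>
            integrable M (\<lambda>\<omega>. (norm (gradG (\<theta> (R \<omega>) \<omega>)))\<^sup>2) \<and>
            (\<integral>\<omega>. (norm (gradG (\<theta> (R \<omega>) \<omega>)))\<^sup>2 \<partial>M)
              \<le> 2 * L1 * (G \<theta>init - G \<theta>star) / real n
                + (2 * (G \<theta>init - G \<theta>star) + L1 * \<sigma>\<^sup>2) / sqrt (real n))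
       \<and> (\<forall>(C1::real) (C2::real) (B::real) (\<delta> :: nat \<Rightarrow> real).
            (\<forall>k\<in>{1..n}. \<delta> k > 0) \<longrightarrow>
            (\<forall>k\<in>{1..n}. AE \<omega> in M.
               norm (vec_cond_exp M (sigma_of M (\<theta> ` {1..k})) (g k) \<omega> - gradG (\<theta> k \<omega>))
                 \<le> C1 * (\<delta> k)\<^sup>2) \<longrightarrow>
            (\<forall>k\<in>{1..n}. integrable M (\<lambda>\<omega>. (norm (g k \<omega>))\<^sup>2) \<and>
               (\<integral>\<omega>. (norm (g k \<omega>))\<^sup>2 \<partial>M) < C2 / (\<delta> k)\<^sup>2) \<longrightarrow>
            (\<forall>x. l1_norm (gradG x) \<le> B) \<longrightarrow>
            (\<forall>k\<in>{1..n}. \<zeta> k = min (1 / L1) (1 / real n powr (2/3))) \<longrightarrow>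
            (\<forall>k\<in>{1..n}. \<delta> k = 1 / real n powr (1/6)) \<longrightarrow>
            integrable M (\<lambda>\<omega>. (norm (gradG (\<theta> (R \<omega>) \<omega>)))\<^sup>2) \<and>
            (\<integral>\<omega>. (norm (gradG (\<theta> (R \<omega>) \<omega>)))\<^sup>2 \<partial>M)
              \<le> 2 * (G \<theta>init - G \<theta>star) / real n * max L1 (real n powr (2/3))
                + (4 * B * C1 + L1 * C2) / real n powr (1/3)
                + L1 * real CARD('d) * C1\<^sup>2 / real n powr (4/3))"
proof (intro conjI allI impI)
  interpret P: prob_space M by fact
  have sgd: "stochastic_gradient M G gradG L1 \<theta>star \<theta>init n z \<theta> g R"
    if "\<forall>k\<in>{1..n}. \<zeta> k = z" for z
    using assms that by unfold_locales auto
  have n: "real n > 0" and gap: "0 \<le> G \<theta>init - G \<theta>star"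
    using assms by auto
  \<comment> \<open>Turns the factor 1/z of the general bounds into the maximum of the
    claim.\<close>
  have inv_min: "1 / min (1 / L1) (1 / r) = max L1 r" if "r > 0" for r :: real
    using that \<open>L1 > 0\<close> by (auto simp: min_def max_def field_simps)
  {
    fix \<sigma> :: real
    assume unbiased: "\<forall>k\<in>{1..n}. AE \<omega> in M.
          vec_cond_exp M (sigma_of M (\<theta> ` {1..k})) (g k) \<omega> = gradG (\<theta> k \<omega>)"
      and noise: "\<forall>k\<in>{1..n}. integrable M (\<lambda>\<omega>. (norm (g k \<omega> - gradG (\<theta> k \<omega>)))\<^sup>2) \<and>
          (\<integral>\<omega>. (norm (g k \<omega> - gradG (\<theta> k \<omega>)))\<^sup>2 \<partial>M) \<le> \<sigma>\<^sup>2"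
      and \<zeta>: "\<forall>k\<in>{1..n}. \<zeta> k = min (1 / L1) (1 / sqrt (real n))"
    define z where "z = min (1 / L1) (1 / sqrt (real n))"
    have z: "0 < z" "z \<le> 1 / L1" "z \<le> 1 / sqrt (real n)"
      using n \<open>L1 > 0\<close> by (auto simp: z_def)
    have inv_z: "1 / z = max L1 (sqrt (real n))"
      using inv_min[of "sqrt (real n)"] n by (simp add: z_def)
    interpret S: stochastic_gradient M G gradG L1 \<theta>star \<theta>init n z \<theta> g R
      using \<zeta> by (intro sgd) (simp add: z_def)
    note bound = S.unbiased_bound[of "\<sigma>\<^sup>2", OF _ _ _ z(1,2)]
    show "integrable M (\<lambda>\<omega>. (norm (gradG (\<theta> (R \<omega>) \<omega>)))\<^sup>2)"
      by (rule bound(1)) (use unbiased noise in auto)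
    have "(\<integral>\<omega>. (norm (gradG (\<theta> (R \<omega>) \<omega>)))\<^sup>2 \<partial>M)
        \<le> 2 * (G \<theta>init - G \<theta>star) / (real n * z) + L1 * z * \<sigma>\<^sup>2"
      by (rule bound(2)) (use unbiased noise in auto)
    also have "\<dots> = 2 * (G \<theta>init - G \<theta>star) / real n * max L1 (sqrt (real n)) + L1 * \<sigma>\<^sup>2 * z"
      unfolding inv_z[symmetric] by simp
    \<comment> \<open>The maximum is at most the sum of its two nonnegative entries, and
      \<open>z\<close> is at most its second entry; this separates the 1/n term from the 1/sqrt n
      term.\<close>
    also have "\<dots> \<le> 2 * (G \<theta>init - G \<theta>star) / real n * (L1 + sqrt (real n))
        + L1 * \<sigma>\<^sup>2 * (1 / sqrt (real n))"
      using z gap n \<open>L1 > 0\<close> by (intro add_mono mult_left_mono) auto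
    also have "\<dots> = 2 * L1 * (G \<theta>init - G \<theta>star) / real n
        + (2 * (G \<theta>init - G \<theta>star) * (sqrt (real n) / real n) + L1 * \<sigma>\<^sup>2 * (1 / sqrt (real n)))"
      by (simp add: distrib_right add_divide_distrib mult_ac)
    also have "sqrt (real n) / real n = 1 / sqrt (real n)"
      using n by (simp add: field_simps)
    finally show "(\<integral>\<omega>. (norm (gradG (\<theta> (R \<omega>) \<omega>)))\<^sup>2 \<partial>M)
        \<le> 2 * L1 * (G \<theta>init - G \<theta>star) / real n
          + (2 * (G \<theta>init - G \<theta>star) + L1 * \<sigma>\<^sup>2) / sqrt (real n)"
      by (simp add: add_divide_distrib)
  next
    fix C1 C2 B :: real and \<delta> :: "nat \<Rightarrow> real"
    assume bias: "\<forall>k\<in>{1..n}. AE \<omega> in M.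
          norm (vec_cond_exp M (sigma_of M (\<theta> ` {1..k})) (g k) \<omega> - gradG (\<theta> k \<omega>))
            \<le> C1 * (\<delta> k)\<^sup>2"
      and second: "\<forall>k\<in>{1..n}. integrable M (\<lambda>\<omega>. (norm (g k \<omega>))\<^sup>2) \<and>
          (\<integral>\<omega>. (norm (g k \<omega>))\<^sup>2 \<partial>M) < C2 / (\<delta> k)\<^sup>2"
      and grad: "\<forall>x. l1_norm (gradG x) \<le> B"
      and \<zeta>: "\<forall>k\<in>{1..n}. \<zeta> k = min (1 / L1) (1 / real n powr (2/3))"
      and \<delta>: "\<forall>k\<in>{1..n}. \<delta> k = 1 / real n powr (1/6)"
    define z where "z = min (1 / L1) (1 / real n powr (2/3))"
    \<comment> \<open>In this unit all powers become integral: \<open>\<delta> k\<close> squared is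
      1/q, so the bias is at most C1/q and the second moment at most C2 q, while z is at most 1/q^2.
      Hence z C2 q is at most C2/q, the same rate as the bias.\<close>
    define q where "q = real n powr (1/3)"
    have q: "q > 0" and q2: "real n powr (2/3) = q * q"
      using n by (auto simp: q_def simp flip: powr_add)
    have z: "0 < z" "z \<le> 1 / (q * q)"
      using n \<open>L1 > 0\<close> by (auto simp: z_def simp flip: q2)
    interpret S: stochastic_gradient M G gradG L1 \<theta>star \<theta>init n z \<theta> g R
      using \<zeta> by (intro sgd) (simp add: z_def)
    have inv_z: "1 / z = max L1 (q * q)"
      using inv_min[of "q * q"] q by (simp add: z_def q2)
    have \<delta>2: "(\<delta> k)\<^sup>2 = 1 / q" if "k \<in> {1..n}" for k
      using that \<delta> n by (simp add: q_def power2_eq_square flip: powr_add)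
    \<comment> \<open>The Euclidean norm is dominated by the l1-norm.\<close>
    have B: "norm (gradG x) \<le> B" for x
      using grad norm_le_l1_cart[of "gradG x"] by (auto simp: l1_norm_def intro: order_trans)
    have one: "1 \<in> {1..n}"
      using \<open>n \<ge> 1\<close> by simp
    \<comment> \<open>Signs of the constants are extracted from the hypotheses: a constant that is
      nonnegative almost everywhere on a probability space is nonnegative, and \<open>C2 * q\<close>
      exceeds a nonnegative integral.\<close>
    have "AE \<omega> in M. 0 \<le> C1 * (\<delta> 1)\<^sup>2"
      using bias[rule_format, OF one] by eventually_elim (rule order_trans[OF norm_ge_zero])
    then have "0 \<le> C1 * (\<delta> 1)\<^sup>2"
      by simp
    then have C1: "0 \<le> C1"
      using q unfolding \<delta>2[OF one] by (simp add: zero_le_divide_iff)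
    have B_nonneg: "0 \<le> B"
      by (rule order_trans[OF norm_ge_zero B])
    have "0 \<le> (\<integral>\<omega>. (norm (g 1 \<omega>))\<^sup>2 \<partial>M)"
      by simp
    also have "\<dots> < C2 * q"
      using second \<delta>2 one by fastforce
    finally have C2: "0 \<le> C2"
      using q by (simp add: zero_less_mult_iff)
    note bound = S.biased_bound[of "C1 * (1 / q)" "C2 * q" B, OF _ _ _ B z(1)]
    show "integrable M (\<lambda>\<omega>. (norm (gradG (\<theta> (R \<omega>) \<omega>)))\<^sup>2)"
      by (rule bound(1)) (use bias second \<delta>2 in fastforce)+
    have "(\<integral>\<omega>. (norm (gradG (\<theta> (R \<omega>) \<omega>)))\<^sup>2 \<partial>M)
        \<le> (G \<theta>init - G \<theta>star) / (real n * z) + B * (C1 * (1 / q)) + L1 / 2 * z * (C2 * q)"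
      by (rule bound(2)) (use bias second \<delta>2 in fastforce)+
    \<comment> \<open>The factor 1 is written out so that monotonicity of products can compare it
      with 4; the coefficients 1, 1, 1/2 are then enlarged to the 2, 4, 1 of the claim.\<close>
    also have "\<dots> = (G \<theta>init - G \<theta>star) / real n * max L1 (q * q)
        + 1 * (B * C1 / q) + (L1 / 2 * C2 * q) * z"
      unfolding inv_z[symmetric] by (simp add: mult_ac)
    also have "\<dots> \<le> 2 * (G \<theta>init - G \<theta>star) / real n * max L1 (q * q)
        + 4 * (B * C1 / q) + (L1 * C2 * q) * (1 / (q * q))"
      using z gap n q C1 C2 B_nonneg \<open>L1 > 0\<close>
      by (intro add_mono mult_mono divide_right_mono) (auto simp: le_max_iff_disj)
    also have "\<dots> = 2 * (G \<theta>init - G \<theta>star) / real n * max L1 (q * q) + (4 * B * C1 + L1 * C2) / q"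
      using q by (simp add: field_simps)
    also have "\<dots> \<le> \<dots> + L1 * real CARD('d) * C1\<^sup>2 / real n powr (4/3)"
      using \<open>L1 > 0\<close> by simp
    finally show "(\<integral>\<omega>. (norm (gradG (\<theta> (R \<omega>) \<omega>)))\<^sup>2 \<partial>M)
        \<le> 2 * (G \<theta>init - G \<theta>star) / real n * max L1 (real n powr (2/3))
          + (4 * B * C1 + L1 * C2) / real n powr (1/3)
          + L1 * real CARD('d) * C1\<^sup>2 / real n powr (4/3)"
      by (simp add: q2 flip: q_def)
  }
qed

end
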